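(* Let $N$ be a Novikov algebra over a field $K$ and let $L$ be a right nilpotent subalgebra of $N$. Then the right ideal $\langle L^2\rangle$ of $N$ generated by $L^2$ is nilpotent.
   Context: A (nonassociative) algebra $N$ over a field $K$ is a Novikov algebra if $(x,y,z)=(y,x,z)$ and $(xy)z=(xz)y$ for all $x,y,z\in N$, where $(x,y,z)=(xy)z-x(yz)$. For subspaces $U,V$, the product $UV$ is the linear span of all $uv$ with $u\in U$, $v\in V$; $L^2=LL$. A right ideal of $N$ is a subspace $I$ with $IN\subseteq I$; $\langle S\rangle$ denotes the right ideal of $N$ generated by a subset $S$. For an algebra $A$: the powers are $A^1=A$, $A^m=\sum_{i=1}^{m-1}A^iA^{m-i}$ for $m\ge 2$, and $A$ is nilpotent if $A^m=0$ for some positive integer $m$; the right powers are $A^{[1]}=A$, $A^{[m+1]}=A^{[m]}A$ for $m\geq 1$, and $A$ is right nilpotent if $A^{[m]}=0$ for some positive integer $m$. *)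

theory Defs
  imports Complex_Main
begin

locale nonassoc_algebra = vector_space scale
  for scale :: "'k::field \<Rightarrow> 'a::ab_group_add \<Rightarrow> 'a" (infixr "*s" 75) +
  fixes mult :: "'a \<Rightarrow> 'a \<Rightarrow> 'a" (infixl "\<bullet>" 70)
  assumes linear_mult_right: "Vector_Spaces.linear scale scale (\<lambda>y. x \<bullet> y)"
    and linear_mult_left: "Vector_Spaces.linear scale scale (\<lambda>x. x \<bullet> y)"
begin

definition associator :: "'a \<Rightarrow> 'a \<Rightarrow> 'a \<Rightarrow> 'a" where
  "associator x y z = (x \<bullet> y) \<bullet> z - x \<bullet> (y \<bullet> z)"

definition set_mult :: "'a set \<Rightarrow> 'a set \<Rightarrow> 'a set" where
  "set_mult U V = span {u \<bullet> v | u v. u \<in> U \<and> v \<in> V}"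

definition subalgebra :: "'a set \<Rightarrow> bool" where
  "subalgebra L \<longleftrightarrow> subspace L \<and> set_mult L L \<subseteq> L"

definition right_ideal :: "'a set \<Rightarrow> bool" where
  "right_ideal I \<longleftrightarrow> subspace I \<and> set_mult I UNIV \<subseteq> I"

definition right_ideal_generated :: "'a set \<Rightarrow> 'a set" where
  "right_ideal_generated S = right_ideal hull S"

text \<open>Powers are only meaningful for exponents at least 1; the value at exponent 0 is a
  dummy that the nilpotency predicates below exclude. The sum of the subspaces
  \<open>A\<^sup>i A\<^sup>m\<^sup>-\<^sup>i\<close> is rendered as the span of their union.\<close>

function alg_power :: "'a set \<Rightarrow> nat \<Rightarrow> 'a set" where
  "alg_power A m =
    (if m \<le> 1 then A
     else span (\<Union>i\<in>{1..<m}. set_mult (alg_power A i) (alg_power A (m - i))))"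
  by pat_completeness auto
termination
  by (relation "measure snd") auto

declare alg_power.simps [simp del]

fun right_power :: "'a set \<Rightarrow> nat \<Rightarrow> 'a set" where
  "right_power A 0 = A"
| "right_power A (Suc 0) = A"
| "right_power A (Suc (Suc m)) = set_mult (right_power A (Suc m)) A"

definition nilpotent :: "'a set \<Rightarrow> bool" where
  "nilpotent A \<longleftrightarrow> (\<exists>m\<ge>1. alg_power A m = {0})"

definition right_nilpotent :: "'a set \<Rightarrow> bool" where
  "right_nilpotent A \<longleftrightarrow> (\<exists>m\<ge>1. right_power A m = {0})"

end

locale novikov_algebra = nonassoc_algebra +
  assumes left_symmetric: "associator x y z = associator y x z"
    and right_commutative: "(x \<bullet> y) \<bullet> z = (x \<bullet> z) \<bullet> y"

end

theory Submission
  imports Defs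
begin

text \<open>
  Let \<open>J\<^sub>0 = \<langle>L\<rangle>\<close> and \<open>J\<^bsub>k+1\<^esub> = J\<^sub>k L\<close>. The theorem holds because these subspaces form a
  multiplicative filtration, \<open>J\<^sub>i J\<^sub>j \<subseteq> J\<^bsub>i+j\<^esub>\<close>, which begins at a right ideal containing \<open>L\<close>
  and which vanishes from some index on when \<open>L\<close> is right nilpotent. Since \<open>\<langle>L\<^sup>2\<rangle> \<subseteq> J\<^sub>1\<close>, every
  product of \<open>m\<close> factors from \<open>\<langle>L\<^sup>2\<rangle>\<close>, however bracketed, then lies in \<open>J\<^sub>m\<close>.

  Right commutativity says that right multiplications commute. Hence every \<open>J\<^sub>k\<close> is a right
  ideal, and \<open>J\<^sub>k\<close> is contained in the right ideal generated by the right power \<open>L\<^bsup>[k+1]\<^esup>\<close>,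
  which is zero for large \<open>k\<close>. It also gives \<open>(xb)y = (xy)b\<close>, so that \<open>J\<^sub>i J\<^sub>j \<subseteq> J\<^bsub>i+j\<^esub>\<close> follows
  from \<open>J\<^sub>0 J\<^sub>j \<subseteq> J\<^sub>j\<close> by induction on \<open>i\<close>, and \<open>J\<^sub>0 J\<^sub>j \<subseteq> J\<^sub>j\<close> follows from \<open>L J\<^sub>j \<subseteq> J\<^sub>j\<close>.

  Left symmetry is what yields \<open>L J\<^sub>j \<subseteq> J\<^sub>j\<close> (lemma \<open>subalgebra_mult_ideal_chain\<close>): for \<open>a, b\<close>
  in \<open>L\<close>, \<open>a(yb) = (ay)b - (ya)b + y(ab)\<close>, and as \<open>ab\<close> lies in \<open>L\<close>, every term
  on the right is in \<open>J\<^sub>j L\<close> as soon as \<open>y\<close> and \<open>ay\<close> are in \<open>J\<^sub>j\<close>; this is the step from \<open>j\<close>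
  to \<open>j+1\<close>.
\<close>

context nonassoc_algebra
begin

lemma module_hom_mult_right: "module_hom scale scale (\<lambda>y. x \<bullet> y)"
  using linear_mult_right by (simp add: module_hom_iff_linear)

lemma module_hom_mult_left: "module_hom scale scale (\<lambda>x. x \<bullet> y)"
  using linear_mult_left by (simp add: module_hom_iff_linear)

lemmas mult_add_right = module_hom.add[OF module_hom_mult_right]
  and mult_scale_right = module_hom.scale[OF module_hom_mult_right]
  and mult_zero_right = module_hom.zero[OF module_hom_mult_right]
  and mult_add_left = module_hom.add[OF module_hom_mult_left]
  and mult_scale_left = module_hom.scale[OF module_hom_mult_left]
  and mult_zero_left = module_hom.zero[OF module_hom_mult_left]

lemma subspace_set_mult: "subspace (set_mult U V)"
  unfolding set_mult_def by (rule subspace_span)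

lemma set_multI: "u \<in> U \<Longrightarrow> v \<in> V \<Longrightarrow> u \<bullet> v \<in> set_mult U V"
  unfolding set_mult_def by (rule span_base) blast

lemma set_mult_subsetI:
  assumes "subspace W" "\<And>u v. u \<in> U \<Longrightarrow> v \<in> V \<Longrightarrow> u \<bullet> v \<in> W"
  shows "set_mult U V \<subseteq> W"
  unfolding set_mult_def by (rule span_minimal) (use assms in auto)

lemma set_mult_mono: "U \<subseteq> U' \<Longrightarrow> V \<subseteq> V' \<Longrightarrow> set_mult U V \<subseteq> set_mult U' V'"
  by (intro set_mult_subsetI subspace_set_mult set_multI) auto

lemma subspace_left_transporter:
  assumes "subspace W"
  shows "subspace {x. \<forall>y\<in>V. x \<bullet> y \<in> W}"
  using assms
  by (auto simp: subspace_def mult_add_left mult_scale_left mult_zero_left)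

lemma subspace_right_transporter:
  assumes "subspace W"
  shows "subspace {y. \<forall>x\<in>V. x \<bullet> y \<in> W}"
  using assms
  by (auto simp: subspace_def mult_add_right mult_scale_right mult_zero_right)

lemma right_ideal_iff:
  "right_ideal I \<longleftrightarrow> subspace I \<and> (\<forall>x\<in>I. \<forall>n. x \<bullet> n \<in> I)"
  unfolding right_ideal_def
  using set_multI[of _ I _ UNIV] set_mult_subsetI[of I I UNIV] by blast

lemma right_ideal_right_ideal_generated: "right_ideal (right_ideal_generated S)"
  unfolding right_ideal_generated_def
proof (rule hull_in)
  fix T assume "\<forall>I\<in>T. right_ideal I"
  then show "right_ideal (\<Inter>T)"
    by (auto simp: right_ideal_iff intro: subspace_Inter)
qed

lemma right_ideal_generated_superset: "S \<subseteq> right_ideal_generated S"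
  unfolding right_ideal_generated_def by (rule hull_subset)

lemma right_ideal_generated_minimal:
  "S \<subseteq> I \<Longrightarrow> right_ideal I \<Longrightarrow> right_ideal_generated S \<subseteq> I"
  unfolding right_ideal_generated_def by (rule hull_minimal)

lemma right_ideal_generated_zero: "right_ideal_generated {0} = {0}"
proof
  have "right_ideal {0}"
    by (simp add: right_ideal_iff subspace_single_0 mult_zero_left)
  then show "right_ideal_generated {0} \<subseteq> {0}"
    by (simp add: right_ideal_generated_minimal)
qed (rule right_ideal_generated_superset)

lemma zero_in_alg_power: "subspace A \<Longrightarrow> 0 \<in> alg_power A m"
  by (subst alg_power.simps) (simp add: span_zero subspace_0)

text \<open>This turns a multiplicative filtration that reaches zero into nilpotency: every
  bracketing of \<open>m\<close> factors splits as a product of shorter ones, whose degrees add.\<close>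

lemma alg_power_subset_filtration:
  assumes sub: "\<And>k. subspace (F k)"
    and mult: "\<And>i j. set_mult (F i) (F j) \<subseteq> F (i + j)"
    and "A \<subseteq> F 1" "m \<ge> 1"
  shows "alg_power A m \<subseteq> F m"
  using \<open>m \<ge> 1\<close>
proof (induction m rule: less_induct)
  case (less m)
  show ?case
  proof (cases "m = 1")
    case True
    then show ?thesis using \<open>A \<subseteq> F 1\<close> by (simp add: alg_power.simps)
  next
    case False
    have "set_mult (alg_power A i) (alg_power A (m - i)) \<subseteq> F m" if "i \<in> {1..<m}" for i
    proof -
      have "set_mult (alg_power A i) (alg_power A (m - i)) \<subseteq> set_mult (F i) (F (m - i))"
        using that by (intro set_mult_mono less.IH) auto
      also have "\<dots> \<subseteq> F m"
        using mult[of i "m - i"] that by simp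
      finally show ?thesis .
    qed
    then have "span (\<Union>i\<in>{1..<m}. set_mult (alg_power A i) (alg_power A (m - i))) \<subseteq> F m"
      by (intro span_minimal sub) blast
    then show ?thesis
      using False less.prems by (subst alg_power.simps) simp
  qed
qed

primrec ideal_chain :: "'a set \<Rightarrow> nat \<Rightarrow> 'a set" where
  "ideal_chain L 0 = right_ideal_generated L"
| "ideal_chain L (Suc k) = set_mult (ideal_chain L k) L"

end

context novikov_algebra
begin

text \<open>Right multiplications commute, so the elements that a family of right multiplications
  sends into a right ideal form a right ideal. A containment \<open>\<langle>S\<rangle>V \<subseteq> I\<close> can therefore be
  checked on \<open>SV\<close>.\<close>

lemma right_ideal_transporter:
  assumes "right_ideal I"
  shows "right_ideal {x. \<forall>y\<in>V. x \<bullet> y \<in> I}"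
proof -
  have "(x \<bullet> n) \<bullet> y \<in> I" if "\<forall>y\<in>V. x \<bullet> y \<in> I" "y \<in> V" for x n y
    using that assms by (simp add: right_commutative[of x n y] right_ideal_iff)
  then show ?thesis
    using assms subspace_left_transporter by (auto simp: right_ideal_iff)
qed

lemma right_ideal_generated_mult_subset:
  assumes "right_ideal I" "\<And>s y. s \<in> S \<Longrightarrow> y \<in> V \<Longrightarrow> s \<bullet> y \<in> I"
    and "x \<in> right_ideal_generated S" "y \<in> V"
  shows "x \<bullet> y \<in> I"
  using right_ideal_generated_minimal[OF _ right_ideal_transporter[OF assms(1), of V], of S]
    assms(2-) by blast

lemma right_ideal_set_mult:
  assumes "right_ideal I"
  shows "right_ideal (set_mult I V)"
proof -
  have "(x \<bullet> v) \<bullet> n \<in> set_mult I V" if "x \<in> I" "v \<in> V" for x v n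
    using that assms by (simp add: right_commutative[of x v n] right_ideal_iff set_multI)
  then have "set_mult I V \<subseteq> {x. \<forall>n\<in>UNIV. x \<bullet> n \<in> set_mult I V}"
    by (intro set_mult_subsetI subspace_left_transporter subspace_set_mult) auto
  then show ?thesis
    by (auto simp: right_ideal_iff subspace_set_mult)
qed

lemma right_ideal_ideal_chain: "right_ideal (ideal_chain L k)"
  by (induction k) (simp_all add: right_ideal_right_ideal_generated right_ideal_set_mult)

lemma subspace_ideal_chain: "subspace (ideal_chain L k)"
  using right_ideal_ideal_chain by (simp add: right_ideal_iff)

text \<open>The next three lemmas build up the multiplicativity of the chain. The first is where left
  symmetry enters: it trades \<open>a(yb)\<close> for \<open>y(ab)\<close> and two products ending in \<open>b\<close>, and
  \<open>y(ab)\<close> is harmless because \<open>L\<close> is closed under products.\<close>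

lemma subalgebra_mult_ideal_chain:
  assumes "subalgebra L" "a \<in> L" "y \<in> ideal_chain L k"
  shows "a \<bullet> y \<in> ideal_chain L k"
  using assms(3)
proof (induction k arbitrary: y)
  case 0
  have "a \<in> right_ideal_generated L"
    using \<open>a \<in> L\<close> right_ideal_generated_superset by blast
  then show ?case
    using right_ideal_right_ideal_generated by (simp add: right_ideal_iff)
next
  case (Suc k)
  let ?J = "ideal_chain L k" and ?J' = "set_mult (ideal_chain L k) L"
  have "a \<bullet> (y \<bullet> b) \<in> ?J'" if y: "y \<in> ?J" and b: "b \<in> L" for y b
  proof -
    have "(a \<bullet> y) \<bullet> b \<in> ?J'"
      using Suc.IH y b by (simp add: set_multI)
    moreover have "(y \<bullet> a) \<bullet> b \<in> ?J'"
      using y b right_ideal_ideal_chain[of L k] by (simp add: right_ideal_iff set_multI)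
    moreover have "a \<bullet> b \<in> L"
      using \<open>subalgebra L\<close> \<open>a \<in> L\<close> b set_multI unfolding subalgebra_def by blast
    then have "y \<bullet> (a \<bullet> b) \<in> ?J'"
      using y by (simp add: set_multI)
    moreover have "a \<bullet> (y \<bullet> b) = (a \<bullet> y) \<bullet> b - (y \<bullet> a) \<bullet> b + y \<bullet> (a \<bullet> b)"
      using left_symmetric[of a y b] unfolding associator_def by (simp add: algebra_simps)
    ultimately show ?thesis
      by (simp add: subspace_add subspace_diff subspace_set_mult)
  qed
  then have "?J' \<subseteq> {y. \<forall>x\<in>{a}. x \<bullet> y \<in> ?J'}"
    by (intro set_mult_subsetI subspace_right_transporter subspace_set_mult) auto
  with Suc.prems show ?case by auto
qed

lemma ideal_chain_mult:
  assumes "subalgebra L" "x \<in> ideal_chain L i" "y \<in> ideal_chain L j"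
  shows "x \<bullet> y \<in> ideal_chain L (i + j)"
  using assms(2)
proof (induction i arbitrary: x)
  case 0
  then show ?case
    using right_ideal_generated_mult_subset[OF right_ideal_ideal_chain
        subalgebra_mult_ideal_chain[OF \<open>subalgebra L\<close>]] \<open>y \<in> ideal_chain L j\<close> by simp
next
  case (Suc i)
  have "(x \<bullet> b) \<bullet> y \<in> ideal_chain L (Suc i + j)" if "x \<in> ideal_chain L i" "b \<in> L" for x b
    using Suc.IH that by (simp add: right_commutative[of x b y] set_multI)
  then have "set_mult (ideal_chain L i) L
      \<subseteq> {x. \<forall>y'\<in>{y}. x \<bullet> y' \<in> ideal_chain L (Suc i + j)}"
    by (intro set_mult_subsetI subspace_left_transporter subspace_ideal_chain) auto
  with Suc.prems show ?case by auto
qed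

lemma set_mult_ideal_chain:
  "subalgebra L \<Longrightarrow>
    set_mult (ideal_chain L i) (ideal_chain L j) \<subseteq> ideal_chain L (i + j)"
  by (intro set_mult_subsetI subspace_ideal_chain ideal_chain_mult)

text \<open>The degree shift comes from \<open>J\<^sub>0\<close> being generated by \<open>L\<close>, which is the first, not the
  zeroth, right power.\<close>

lemma ideal_chain_subset_right_power:
  "ideal_chain L k \<subseteq> right_ideal_generated (right_power L (Suc k))"
proof (induction k)
  case (Suc k)
  let ?P = "right_power L (Suc k)"
  have I: "right_ideal (right_ideal_generated (set_mult ?P L))"
    by (rule right_ideal_right_ideal_generated)
  have "s \<bullet> b \<in> right_ideal_generated (set_mult ?P L)" if "s \<in> ?P" "b \<in> L" for s b
    using set_multI[OF that] right_ideal_generated_superset by blast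
  then have "x \<bullet> b \<in> right_ideal_generated (set_mult ?P L)"
    if "x \<in> ideal_chain L k" "b \<in> L" for x b
    using right_ideal_generated_mult_subset[OF I] Suc.IH that by blast
  then have "set_mult (ideal_chain L k) L \<subseteq> right_ideal_generated (set_mult ?P L)"
    using I by (intro set_mult_subsetI) (simp_all add: right_ideal_iff)
  then show ?case by simp
qed simp

lemma right_ideal_generated_square_subset:
  "right_ideal_generated (set_mult L L) \<subseteq> ideal_chain L 1"
proof (rule right_ideal_generated_minimal[OF _ right_ideal_ideal_chain])
  show "set_mult L L \<subseteq> ideal_chain L 1"
    by (simp add: set_mult_mono right_ideal_generated_superset)
qed

lemma nilpotent_right_ideal_generated_square:
  assumes "subalgebra L" "right_nilpotent L"
  shows "nilpotent (right_ideal_generated (set_mult L L))"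
proof -
  let ?I = "right_ideal_generated (set_mult L L)"
  obtain k where "right_power L (Suc k) = {0}"
    using \<open>right_nilpotent L\<close> unfolding right_nilpotent_def
    by (metis One_nat_def Suc_le_D)
  then have zero: "ideal_chain L k \<subseteq> {0}"
    using ideal_chain_subset_right_power[of L k] right_ideal_generated_zero by simp
  \<comment> \<open>One further step makes the exponent positive; the chain stays zero.\<close>
  have "ideal_chain L (Suc k) \<subseteq> {0}"
    unfolding ideal_chain.simps
    by (rule set_mult_subsetI[OF subspace_single_0]) (use zero mult_zero_left in auto)
  moreover have "alg_power ?I (Suc k) \<subseteq> ideal_chain L (Suc k)"
    using assms(1)
    by (intro alg_power_subset_filtration subspace_ideal_chain set_mult_ideal_chain
        right_ideal_generated_square_subset) auto
  moreover have "0 \<in> alg_power ?I (Suc k)"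
    using right_ideal_right_ideal_generated by (simp add: zero_in_alg_power right_ideal_iff)
  ultimately have "alg_power ?I (Suc k) = {0}" by blast
  then show ?thesis
    unfolding nilpotent_def by (metis One_nat_def Suc_le_mono zero_le)
qed

end

theorem theorem1:
  fixes scale :: "'k::field \<Rightarrow> 'a::ab_group_add \<Rightarrow> 'a"
    and mult :: "'a \<Rightarrow> 'a \<Rightarrow> 'a"
    and L :: "'a set"
  assumes "novikov_algebra scale mult"
    and "nonassoc_algebra.subalgebra scale mult L"
    and "nonassoc_algebra.right_nilpotent scale mult L"
  shows "nonassoc_algebra.nilpotent scale mult
    (nonassoc_algebra.right_ideal_generated scale mult
      (nonassoc_algebra.set_mult scale mult L L))"
  using assms by (rule novikov_algebra.nilpotent_right_ideal_generated_square)

end
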